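(* Let $(F_1,\dots,F_N)$ be a non-degenerate iterated function system of surjective maps on a complete metric space $(T,d)$, let $X=\{1,\dots,N\}^\infty$ with shift map $\sigma$, and let $L$ be the associated fractafold bundle, with projection $\pi:L\to X$, $\pi(x,t)=x$. The map $\tilde\sigma:L\to L$ defined by $\tilde\sigma(x,t)=(\sigma(x),F_{x_1}(t))$ is a local homeomorphism on $L$ such that $\pi\circ\tilde\sigma=\sigma\circ\pi$.
   Context: Iterated function system: $(T,d)$ is a complete metric space and $F_1,\dots,F_N:T\to T$ are maps for which there are constants $0<r_i\le R_i<1$ with $r_i d(t,t')\le d(F_i(t),F_i(t'))\le R_i d(t,t')$ for all $t,t'\in T$ (non-degeneracy); each $F_i$ is surjective, hence a homeomorphism. $K\subset T$ is the unique (non-empty) compact set with $K=F_1(K)\cup\dots\cup F_N(K)$. Words: $W=\{1,\dots,N\}$, $W^*=\bigcup_{n\in\mathbb{N}}W^n$, and $X=W^\infty$ is the space of infinite sequences with the topology generated by the cylinders $Z(\omega)=\{x\in X:x_i=\omega_i,\ i=1,\dots,|\omega|\}$, $\omega\in W^*$. The shift is $\sigma(x_1x_2x_3\cdots)=x_2x_3\cdots$. For $\omega\in W^n$, $F_\omega=F_{\omega_n}\circ\dots\circ F_{\omega_1}$ and $F_\omega^{-1}=F_{\omega_1}^{-1}\circ\dots\circ F_{\omega_n}^{-1}$. Fractafold bundle: for $\omega\in W^n$ put $L_n(\omega)=F_\omega^{-1}(K)$; for $n\ge0$ let $L_n=\bigsqcup_{\omega\in W^n}Z(\omega)\times L_n(\omega)\subset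 X\times T$ with the subspace topology (so $L_0=X\times K$). Then $L_n\subset L_{n+1}$, and $L=\bigcup_{n\ge0}L_n$ with the inductive limit topology: $U\subset L$ is open iff $U\cap L_n$ is open in $L_n$ for every $n\ge0$. *)

theory Defs
  imports "HOL-Analysis.Analysis" "HOL-Library.Stream"
begin

definition nondegenerate_ifs :: "nat \<Rightarrow> (nat \<Rightarrow> 'a::complete_space \<Rightarrow> 'a) \<Rightarrow> bool" where
  "nondegenerate_ifs N F \<longleftrightarrow>
     1 \<le> N \<and>
     (\<forall>i\<in>{1..N}. \<exists>r R. 0 < r \<and> r \<le> R \<and> R < 1 \<and>
        (\<forall>t t'. r * dist t t' \<le> dist (F i t) (F i t') \<and>
                dist (F i t) (F i t') \<le> R * dist t t'))"

text \<open>Existence and uniqueness of the attractor of a non-degenerate IFS is Hutchinson's theorem.\<close>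

definition ifs_attractor :: "nat \<Rightarrow> (nat \<Rightarrow> 'a::complete_space \<Rightarrow> 'a) \<Rightarrow> 'a set" where
  "ifs_attractor N F = (THE K. K \<noteq> {} \<and> compact K \<and> K = (\<Union>i\<in>{1..N}. F i ` K))"

text \<open>
  Infinite sequences over \<open>{1..N}\<close> are elements of \<open>streams {1..N}\<close>, with shift map \<open>stl\<close>;
  finite words are lists over \<open>{1..N}\<close>, including the empty one.
\<close>

definition words :: "nat \<Rightarrow> nat \<Rightarrow> nat list set" where
  "words N n = {\<omega>. set \<omega> \<subseteq> {1..N} \<and> length \<omega> = n}"

definition cylinder :: "nat \<Rightarrow> nat list \<Rightarrow> nat stream set" where
  "cylinder N \<omega> = {x \<in> streams {1..N}. stake (length \<omega>) x = \<omega>}"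

definition sequence_space :: "nat \<Rightarrow> nat stream topology" where
  "sequence_space N = topology_generated_by {cylinder N \<omega> | \<omega>. \<omega> \<in> lists {1..N}}"

text \<open>
  For \<open>\<omega> = [\<omega>\<^sub>1, \<dots>, \<omega>\<^sub>n]\<close> the map \<open>fold F \<omega>\<close> is \<open>F \<omega>\<^sub>n \<circ> \<dots> \<circ> F \<omega>\<^sub>1\<close>.
\<close>

definition fiber :: "nat \<Rightarrow> (nat \<Rightarrow> 'a::complete_space \<Rightarrow> 'a) \<Rightarrow> nat list \<Rightarrow> 'a set" where
  "fiber N F \<omega> = fold F \<omega> -` ifs_attractor N F"

definition bundle_level :: "nat \<Rightarrow> (nat \<Rightarrow> 'a::complete_space \<Rightarrow> 'a) \<Rightarrow> nat \<Rightarrow> (nat stream \<times> 'a) set" where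
  "bundle_level N F n = (\<Union>\<omega>\<in>words N n. cylinder N \<omega> \<times> fiber N F \<omega>)"

definition bundle_level_topology ::
    "nat \<Rightarrow> (nat \<Rightarrow> 'a::complete_space \<Rightarrow> 'a) \<Rightarrow> nat \<Rightarrow> (nat stream \<times> 'a) topology" where
  "bundle_level_topology N F n =
     subtopology (prod_topology (sequence_space N) euclidean) (bundle_level N F n)"

definition fractafold_bundle :: "nat \<Rightarrow> (nat \<Rightarrow> 'a::complete_space \<Rightarrow> 'a) \<Rightarrow> (nat stream \<times> 'a) set" where
  "fractafold_bundle N F = (\<Union>n. bundle_level N F n)"

definition fractafold_topology ::
    "nat \<Rightarrow> (nat \<Rightarrow> 'a::complete_space \<Rightarrow> 'a) \<Rightarrow> (nat stream \<times> 'a) topology" where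
  "fractafold_topology N F =
     topology (\<lambda>U. U \<subseteq> fractafold_bundle N F \<and>
       (\<forall>n. openin (bundle_level_topology N F n) (U \<inter> bundle_level N F n)))"

lemma openin_fractafold_topology:
  "openin (fractafold_topology N F) U \<longleftrightarrow>
     U \<subseteq> fractafold_bundle N F \<and>
     (\<forall>n. openin (bundle_level_topology N F n) (U \<inter> bundle_level N F n))"
proof -
  let ?P = "\<lambda>U. U \<subseteq> fractafold_bundle N F \<and>
    (\<forall>n. openin (bundle_level_topology N F n) (U \<inter> bundle_level N F n))"
  have "?P (S \<inter> T)" if "?P S" "?P T" for S T
  proof -
    have "S \<inter> T \<inter> bundle_level N F n = (S \<inter> bundle_level N F n) \<inter> (T \<inter> bundle_level N F n)" for n
      by blast
    with that show ?thesis
      by (metis openin_Int le_infI1)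
  qed
  moreover have "?P (\<Union>\<K>)" if "\<forall>S\<in>\<K>. ?P S" for \<K>
  proof -
    have "openin (bundle_level_topology N F n) (\<Union>\<K> \<inter> bundle_level N F n)" for n
      unfolding Int_Union2 using that by (intro openin_Union) auto
    with that show ?thesis
      by (simp add: Sup_le_iff)
  qed
  ultimately have "istopology ?P"
    unfolding istopology_def by simp
  then show ?thesis
    unfolding fractafold_topology_def by (rule topology_inverse'[THEN fun_cong])
qed

lemma topspace_sequence_space: "topspace (sequence_space N) = streams {1..N}"
proof -
  have "cylinder N [] = streams {1..N}"
    by (simp add: cylinder_def)
  moreover have "cylinder N \<omega> \<subseteq> streams {1..N}" for \<omega>
    by (auto simp: cylinder_def)
  moreover have "[] \<in> lists {1..N}"
    by simp
  ultimately show ?thesis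
    unfolding sequence_space_def topology_generated_by_topspace by blast
qed

lemma topspace_bundle_level_topology:
  "topspace (bundle_level_topology N F n) = bundle_level N F n"
  by (auto simp: bundle_level_topology_def topspace_sequence_space bundle_level_def cylinder_def)

lemma topspace_fractafold_topology:
  "topspace (fractafold_topology N F) = fractafold_bundle N F"
proof -
  have "fractafold_bundle N F \<inter> bundle_level N F n = topspace (bundle_level_topology N F n)" for n
    by (auto simp: fractafold_bundle_def topspace_bundle_level_topology)
  then have "openin (fractafold_topology N F) (fractafold_bundle N F)"
    unfolding openin_fractafold_topology by (metis openin_topspace order_refl)
  then show ?thesis
    by (metis openin_fractafold_topology openin_subset openin_topspace subset_antisym)
qed

definition bundle_shift :: "(nat \<Rightarrow> 'a \<Rightarrow> 'a) \<Rightarrow> nat stream \<times> 'a \<Rightarrow> nat stream \<times> 'a" where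
  "bundle_shift F = (\<lambda>(x, t). (stl x, F (shd x) t))"

definition local_homeomorphism :: "'a topology \<Rightarrow> 'b topology \<Rightarrow> ('a \<Rightarrow> 'b) \<Rightarrow> bool" where
  "local_homeomorphism X Y f \<longleftrightarrow>
     f \<in> topspace X \<rightarrow> topspace Y \<and>
     (\<forall>p\<in>topspace X. \<exists>U. openin X U \<and> p \<in> U \<and> openin Y (f ` U) \<and>
        homeomorphic_map (subtopology X U) (subtopology Y (f ` U)) f)"

end

theory Submission
  imports Defs
begin

text \<open>
  On the clopen piece of \<open>L\<close> over the cylinder of the letter \<open>i\<close>, the map \<open>(x, t) \<mapsto> (\<sigma> x, F\<^sub>i t)\<close>
  is a bijection onto all of \<open>L\<close>, with inverse \<open>(y, s) \<mapsto> (i y, F\<^sub>i\<inverse> s)\<close>. The map and its inverse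
  are continuous on \<open>X \<times> T\<close> and send \<open>L\<^sub>n\<close> into \<open>L\<^sub>n\<close> and \<open>L\<^sub>n\<^sub>+\<^sub>1\<close> respectively, so both are continuous
  for the inductive limit topology. The only property of \<open>K\<close> involved is \<open>F\<^sub>i K \<subseteq> K\<close>, which
  needs Hutchinson's theorem because \<open>K\<close> is a definite description. Its existence part follows by
  taking the closure of the orbit \<open>P\<close> of the fixed point of \<open>F\<^sub>1\<close> under all words: \<open>P\<close> is bounded
  and \<open>P = \<Union>\<^sub>i F\<^sub>i P\<close>, so a finite \<open>\<epsilon>\<close>-net of \<open>P\<close> yields a finite \<open>R \<epsilon>\<close>-net.
\<close>

section \<open>Hutchinson's theorem\<close>

lemma contractions_totally_bounded:
  fixes F :: "'i \<Rightarrow> 'a::metric_space \<Rightarrow> 'a"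
  assumes "finite I" "bounded P" "P \<subseteq> (\<Union>i\<in>I. F i ` P)" "R < 1"
    and contr: "\<And>i x y. i \<in> I \<Longrightarrow> dist (F i x) (F i y) \<le> R * dist x y"
    and "0 < R"
  shows "\<forall>e>0. \<exists>k. finite k \<and> P \<subseteq> (\<Union>x\<in>k. ball x e)"
proof (intro allI impI)
  fix e :: real assume "e > 0"
  obtain a b where ab: "P \<subseteq> ball a b" "b > 0"
    using bounded_subset_ballD[OF \<open>bounded P\<close>] by blast
  \<comment> \<open>The induction starts from a single ball of radius \<open>b\<close> containing
    \<open>P\<close>. Each round replaces the centres by their images under all the maps. The
    centres need not stay in \<open>P\<close>, since the contraction bound holds on the whole
    space.\<close>
  have net: "\<exists>k. finite k \<and> P \<subseteq> (\<Union>x\<in>k. ball x (R ^ n * b))" for n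
  proof (induction n)
    case 0
    show ?case using ab by (intro exI[of _ "{a}"]) auto
  next
    case (Suc n)
    then obtain k where k: "finite k" "P \<subseteq> (\<Union>x\<in>k. ball x (R ^ n * b))" by blast
    have "P \<subseteq> (\<Union>x\<in>(\<Union>i\<in>I. F i ` k). ball x (R ^ Suc n * b))"
    proof
      fix y assume "y \<in> P"
      then obtain i p where ip: "i \<in> I" "p \<in> P" "y = F i p" using assms(3) by blast
      then obtain x where x: "x \<in> k" "dist x p < R ^ n * b" using k by auto
      have "dist (F i x) y \<le> R * dist x p" using contr ip by simp
      also have "\<dots> < R * (R ^ n * b)" using x \<open>0 < R\<close> by simp
      finally show "y \<in> (\<Union>x\<in>(\<Union>i\<in>I. F i ` k). ball x (R ^ Suc n * b))"
        using ip x by (auto simp: mult.assoc)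
    qed
    then show ?case using k \<open>finite I\<close> by (intro exI[of _ "\<Union>i\<in>I. F i ` k"]) auto
  qed
  obtain n where n: "R ^ n < e / b"
    using real_arch_pow_inv[of "e / b" R] \<open>e > 0\<close> \<open>b > 0\<close> \<open>R < 1\<close> by auto
  then have "R ^ n * b \<le> e" using \<open>b > 0\<close> by (simp add: field_simps)
  moreover obtain k where "finite k" "P \<subseteq> (\<Union>x\<in>k. ball x (R ^ n * b))" using net by blast
  ultimately show "\<exists>k. finite k \<and> P \<subseteq> (\<Union>x\<in>k. ball x e)"
    using subset_ball[of "R ^ n * b" e] by (intro exI[of _ k]) blast
qed

lemma dist_bound_imp_continuous_on:
  fixes f :: "'a::metric_space \<Rightarrow> 'b::metric_space"
  assumes "\<And>x y. dist (f x) (f y) \<le> R * dist x y"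
  shows "continuous_on A f"
proof -
  \<comment> \<open>A Lipschitz constant has to be nonnegative, and nothing is assumed about the
    sign of \<open>R\<close>.\<close>
  have "(max R 0)-lipschitz_on A f"
  proof (rule lipschitz_onI)
    fix x y
    have "dist (f x) (f y) \<le> R * dist x y" by (rule assms)
    also have "\<dots> \<le> max R 0 * dist x y" by (intro mult_right_mono) auto
    finally show "dist (f x) (f y) \<le> max R 0 * dist x y" .
  qed simp
  then show ?thesis by (rule lipschitz_on_continuous_on)
qed

lemma contractions_invariant_compact_exists:
  fixes F :: "'i \<Rightarrow> 'a::complete_space \<Rightarrow> 'a"
  assumes "finite I" "I \<noteq> {}" "0 < R" "R < 1"
    and contr: "\<And>i x y. i \<in> I \<Longrightarrow> dist (F i x) (F i y) \<le> R * dist x y"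
  shows "\<exists>K. K \<noteq> {} \<and> compact K \<and> K = (\<Union>i\<in>I. F i ` K)"
proof -
  obtain j where j: "j \<in> I" using \<open>I \<noteq> {}\<close> by blast
  obtain p where p: "F j p = p"
    using banach_fix_type[of R "F j"] contr[OF j] \<open>0 < R\<close> \<open>R < 1\<close> by auto
  \<comment> \<open>\<open>foldr\<close> applies the first letter last, so prepending
    \<open>i\<close> to a word applies \<open>F i\<close> on the outside. This makes
    \<open>P\<close> closed under every \<open>F i\<close>.\<close>
  define P where "P = (\<lambda>w. foldr F w p) ` lists I"
  have pP: "p \<in> P" unfolding P_def by (rule image_eqI[of _ _ "[]"]) auto
  have FP: "F i x \<in> P" if "i \<in> I" "x \<in> P" for i x
  proof -
    from that obtain w where "w \<in> lists I" "x = foldr F w p" unfolding P_def by blast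
    then show ?thesis unfolding P_def using that by (intro image_eqI[of _ _ "i # w"]) auto
  qed
  have "foldr F w p \<in> (\<Union>i\<in>I. F i ` P)" if "w \<in> lists I" for w
  proof (cases w)
    case Nil
    \<comment> \<open>The empty word has no letter to split off; here \<open>p = F j p\<close> puts
      \<open>p\<close> into the union.\<close>
    then show ?thesis using pP p j by force
  next
    case (Cons i v)
    then show ?thesis using that unfolding P_def by auto
  qed
  then have P_sub: "P \<subseteq> (\<Union>i\<in>I. F i ` P)" by (subst P_def) blast
  then have P_eq: "P = (\<Union>i\<in>I. F i ` P)" using FP by blast
  \<comment> \<open>This is the radius for which \<open>(1 - R) * M + R * M = M\<close> closes the
    induction on words: one application of a map moves \<open>p\<close> by at most
    \<open>(1 - R) * M\<close> and shrinks the earlier distance by the factor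
    \<open>R\<close>.\<close>
  define M where "M = Max ((\<lambda>i. dist p (F i p)) ` I) / (1 - R)"
  have M: "dist p (F i p) \<le> (1 - R) * M" if "i \<in> I" for i
    using that assms by (simp add: M_def)
  have "0 \<le> (1 - R) * M" using M[OF j] p by simp
  then have "0 \<le> M" using \<open>R < 1\<close> by (simp add: zero_le_mult_iff)
  have "dist p (foldr F w p) \<le> M" if "w \<in> lists I" for w
    using that
  proof (induction w)
    case Nil
    show ?case using \<open>0 \<le> M\<close> by simp
  next
    case (Cons i w)
    have "dist p (F i (foldr F w p)) \<le> dist p (F i p) + dist (F i p) (F i (foldr F w p))"
      by (rule dist_triangle)
    also have "\<dots> \<le> (1 - R) * M + R * dist p (foldr F w p)"
      using M contr Cons.hyps by (intro add_mono) auto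
    also have "\<dots> \<le> (1 - R) * M + R * M" using Cons.IH \<open>0 < R\<close> by simp
    finally show ?case by (simp add: algebra_simps)
  qed
  then have bdd: "bounded P" unfolding bounded_def P_def by blast
  \<comment> \<open>Total boundedness passes to the closure by halving the radius: finitely many
    closed balls of radius \<open>e/2\<close> form a closed cover, and each lies in the open ball of
    radius \<open>e\<close>.\<close>
  have "\<exists>k. finite k \<and> closure P \<subseteq> (\<Union>x\<in>k. ball x e)" if "e > 0" for e
  proof -
    obtain k where k: "finite k" "P \<subseteq> (\<Union>x\<in>k. ball x (e/2))"
      using contractions_totally_bounded[OF \<open>finite I\<close> bdd P_sub \<open>R < 1\<close> contr \<open>0 < R\<close>]
        half_gt_zero[OF \<open>e > 0\<close>] by blast
    have "P \<subseteq> (\<Union>x\<in>k. cball x (e/2))"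
      using k(2) ball_subset_cball by blast
    then have "closure P \<subseteq> (\<Union>x\<in>k. cball x (e/2))"
      using k(1) by (intro closure_minimal closed_UN) auto
    also have "\<dots> \<subseteq> (\<Union>x\<in>k. ball x e)"
      using \<open>e > 0\<close> by (intro UN_mono) auto
    finally show ?thesis using k by blast
  qed
  then have comp: "compact (closure P)"
    unfolding compact_eq_totally_bounded by (simp add: complete_eq_closed)
  \<comment> \<open>The image of the compact set \<open>closure P\<close> is compact, hence closed,
    which gives one inclusion; continuity gives the other.\<close>
  have closure_image: "closure (F i ` P) = F i ` closure P" if "i \<in> I" for i
  proof
    have cont: "continuous_on (closure P) (F i)"
      using contr[OF that] by (rule dist_bound_imp_continuous_on)
    then have "closed (F i ` closure P)"
      using comp by (intro compact_imp_closed compact_continuous_image)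
    then show "closure (F i ` P) \<subseteq> F i ` closure P"
      by (intro closure_minimal image_mono closure_subset)
    show "F i ` closure P \<subseteq> closure (F i ` P)"
      using cont by (intro image_closure_subset) (auto simp: closure_subset)
  qed
  have "closure P = closure (\<Union>i\<in>I. F i ` P)" by (rule arg_cong[OF P_eq])
  also have "\<dots> = (\<Union>i\<in>I. closure (F i ` P))" 
    using \<open>finite I\<close> by (induction I) simp_all
  also have "\<dots> = (\<Union>i\<in>I. F i ` closure P)" by (intro SUP_cong refl closure_image)
  finally have inv: "closure P = (\<Union>i\<in>I. F i ` closure P)" .
  have "closure P \<noteq> {}" using pP by auto
  with comp inv show ?thesis by (intro exI conjI)
qed

text \<open>Take \<open>a\<close> in \<open>A\<close> farthest from \<open>B\<close> and write
  \<open>a = F i x\<close> with \<open>x\<close> in \<open>A\<close>. Contraction gives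
  \<open>infdist a B \<le> R * infdist x B \<le> R * infdist a B\<close>, so this largest distance
  is zero. Used in both directions, this is the uniqueness of the attractor. Nonemptiness of
  \<open>B\<close> matters because \<open>infdist\<close> to the empty set is 0 by
  convention.\<close>

lemma contractions_invariant_compact_subset:
  fixes F :: "'i \<Rightarrow> 'a::metric_space \<Rightarrow> 'a"
  assumes "0 < R" "R < 1"
    and contr: "\<And>i x y. i \<in> I \<Longrightarrow> dist (F i x) (F i y) \<le> R * dist x y"
    and A: "compact A" "A = (\<Union>i\<in>I. F i ` A)"
    and B: "B \<noteq> {}" "compact B" "B = (\<Union>i\<in>I. F i ` B)"
  shows "A \<subseteq> B"
proof (cases "A = {}")
  case False
  obtain a where a: "a \<in> A" "\<And>x. x \<in> A \<Longrightarrow> infdist x B \<le> infdist a B"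
    using continuous_attains_sup[OF \<open>compact A\<close> False continuous_on_infdist[OF continuous_on_id], of B]
    by blast
  obtain i x where ix: "i \<in> I" "x \<in> A" "a = F i x" using A a by blast
  \<comment> \<open>Compactness of \<open>B\<close> yields a nearest point \<open>b\<close> to
    \<open>x\<close>, whose image \<open>F i b\<close> is again in \<open>B\<close> and bounds the
    distance from \<open>a\<close>.\<close>
  have "continuous_on B (dist x)" by (intro continuous_intros)
  then obtain b where b: "b \<in> B" "\<And>y. y \<in> B \<Longrightarrow> dist x b \<le> dist x y"
    using continuous_attains_inf[OF B(2,1)] by metis
  then have "dist x b \<le> infdist x B"
    using B(1) by (auto simp: infdist_notempty intro: cINF_greatest)
  have "infdist a B \<le> dist a (F i b)" using B(3) b(1) ix by (intro infdist_le) blast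
  also have "\<dots> \<le> R * dist x b" using ix contr by simp
  also have "\<dots> \<le> R * infdist x B" using \<open>0 < R\<close> \<open>dist x b \<le> infdist x B\<close> by simp
  finally have *: "infdist a B \<le> R * infdist x B" .
  have "infdist a B \<le> 0"
  proof (rule ccontr)
    assume neg: "\<not> infdist a B \<le> 0"
    have "infdist x B > 0"
      using neg * infdist_nonneg[of x B] by (cases "infdist x B = 0") auto
    then have "R * infdist x B < infdist x B" using \<open>R < 1\<close> by simp
    then show False using * a(2)[OF ix(2)] by simp
  qed
  then have "infdist x B = 0" if "x \<in> A" for x
    using a(2)[OF that] infdist_nonneg[of x B] by linarith
  then show ?thesis
    using in_closed_iff_infdist_zero[OF compact_imp_closed[OF B(2)] B(1)] by blast
qed simp

text \<open>The constants may differ from map to map. There are finitely many maps and at least one,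
  so the maximum is attained and stays strictly between 0 and 1.\<close>

lemma nondegenerate_ifs_uniform_contraction:
  assumes "nondegenerate_ifs N F"
  obtains R where "0 < R" "R < 1"
    "\<And>i x y. i \<in> {1..N} \<Longrightarrow> dist (F i x) (F i y) \<le> R * dist x y"
proof -
  have "\<forall>i\<in>{1..N}. \<exists>R. 0 < R \<and> R < 1 \<and> (\<forall>x y. dist (F i x) (F i y) \<le> R * dist x y)"
    using assms unfolding nondegenerate_ifs_def by (meson less_le_trans)
  then obtain R where R: "\<And>i. i \<in> {1..N} \<Longrightarrow> 0 < R i \<and> R i < 1"
    "\<And>i x y. i \<in> {1..N} \<Longrightarrow> dist (F i x) (F i y) \<le> R i * dist x y" by metis
  have "1 \<le> N" using assms by (simp add: nondegenerate_ifs_def)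
  define S where "S = Max (R ` {1..N})"
  have fin: "finite (R ` {1..N})" "R ` {1..N} \<noteq> {}" using \<open>1 \<le> N\<close> by auto
  have "S \<in> R ` {1..N}" unfolding S_def by (rule Max_in[OF fin])
  then have "0 < S" "S < 1" using R(1) by auto
  moreover have "dist (F i x) (F i y) \<le> S * dist x y" if "i \<in> {1..N}" for i x y
  proof -
    have "R i \<le> S" unfolding S_def using that by (intro Max_ge fin) auto
    then show ?thesis using R(2)[OF that, of x y] by (meson mult_right_mono order_trans zero_le_dist)
  qed
  ultimately show ?thesis by (rule that)
qed

lemma ifs_attractor_invariant:
  assumes "nondegenerate_ifs N F"
  shows "ifs_attractor N F = (\<Union>i\<in>{1..N}. F i ` ifs_attractor N F)"
proof -
  obtain R where R: "0 < R" "R < 1"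
    "\<And>i x y. i \<in> {1..N} \<Longrightarrow> dist (F i x) (F i y) \<le> R * dist x y"
    using nondegenerate_ifs_uniform_contraction[OF assms] by blast
  define Q where "Q K \<longleftrightarrow> K \<noteq> {} \<and> compact K \<and> K = (\<Union>i\<in>{1..N}. F i ` K)" for K
  have "{1..N} \<noteq> {}" using assms by (simp add: nondegenerate_ifs_def)
  from contractions_invariant_compact_exists[where F = F, OF finite_atLeastAtMost this R]
  obtain K where K: "Q K" unfolding Q_def ..
  have QD: "K \<noteq> {}" "compact K" "K = (\<Union>i\<in>{1..N}. F i ` K)" if "Q K" for K
    using that[unfolded Q_def] by (rule conjunct1 conjunct2[THEN conjunct1] conjunct2[THEN conjunct2])+
  have subset: "A \<subseteq> B" if "Q A" "Q B" for A B
    using contractions_invariant_compact_subset[where F = F and I = "{1..N}",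
        OF R QD(2,3)[OF that(1)] QD[OF that(2)]] .
  have "\<exists>!K. Q K"
    using K by (rule ex1I) (intro subset_antisym subset K)
  then have "Q (THE K. Q K)" by (rule theI')
  moreover have "ifs_attractor N F = (THE K. Q K)"
    by (simp only: ifs_attractor_def Q_def)
  ultimately have "Q (ifs_attractor N F)" by simp
  then show ?thesis by (rule QD(3))
qed

section \<open>Shift and prefixing on the sequence space\<close>

lemma openin_cylinder:
  assumes "\<omega> \<in> lists {1..N}"
  shows "openin (sequence_space N) (cylinder N \<omega>)"
  unfolding sequence_space_def using assms by (intro topology_generated_by_Basis) blast

lemma continuous_map_into_sequence_space:
  assumes "\<And>\<omega>. \<omega> \<in> lists {1..N} \<Longrightarrow> openin T (f -` cylinder N \<omega> \<inter> topspace T)"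
    and "f \<in> topspace T \<rightarrow> topspace (sequence_space N)"
  shows "continuous_map T (sequence_space N) f"
  using assms
  unfolding sequence_space_def continuous_on_generated_topo_iff topology_generated_by_topspace
  by blast

lemma continuous_map_stl: "continuous_map (sequence_space N) (sequence_space N) stl"
proof -
  have "openin (sequence_space N) (stl -` cylinder N \<omega> \<inter> topspace (sequence_space N))"
    if "\<omega> \<in> lists {1..N}" for \<omega>
  proof -
    have "stl -` cylinder N \<omega> \<inter> topspace (sequence_space N) = (\<Union>i\<in>{1..N}. cylinder N (i # \<omega>))"
      by (auto simp: topspace_sequence_space cylinder_def streams_stl simp del: atLeastAtMost_iff
          dest: streams_shd)
    then show ?thesis using that by (auto intro!: openin_Union openin_cylinder)
  qed
  moreover have "stl \<in> topspace (sequence_space N) \<rightarrow> topspace (sequence_space N)"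
    by (auto simp: topspace_sequence_space streams_stl)
  ultimately show ?thesis
    by (intro continuous_map_into_sequence_space)
qed

lemma continuous_map_SCons:
  assumes "i \<in> {1..N}"
  shows "continuous_map (sequence_space N) (sequence_space N) ((##) i)"
proof -
  have "openin (sequence_space N) ((##) i -` cylinder N \<omega> \<inter> topspace (sequence_space N))"
    if "\<omega> \<in> lists {1..N}" for \<omega>
  proof (cases \<omega>)
    case Nil
    then have "(##) i -` cylinder N \<omega> \<inter> topspace (sequence_space N) = topspace (sequence_space N)"
      using assms by (auto simp: topspace_sequence_space cylinder_def streams_Stream)
    then show ?thesis by simp
  next
    case (Cons j v)
    then have "(##) i -` cylinder N \<omega> \<inter> topspace (sequence_space N) =
        (if i = j then cylinder N v else {})"
      using assms by (auto simp: topspace_sequence_space cylinder_def streams_Stream)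
    then show ?thesis using that Cons by (auto intro: openin_cylinder)
  qed
  moreover have "(##) i \<in> topspace (sequence_space N) \<rightarrow> topspace (sequence_space N)"
    using assms by (auto simp: topspace_sequence_space streams_Stream)
  ultimately show ?thesis
    by (intro continuous_map_into_sequence_space)
qed

text \<open>The second coordinate uses a map that depends on the first letter. That letter is
  locally constant, so the preimage of an open set splits into open boxes, one for each
  letter.\<close>

lemma continuous_map_bundle_shift:
  fixes F :: "nat \<Rightarrow> 'a::topological_space \<Rightarrow> 'a"
  assumes "\<And>i. i \<in> {1..N} \<Longrightarrow> continuous_on UNIV (F i)"
  shows "continuous_map (prod_topology (sequence_space N) euclidean)
           (prod_topology (sequence_space N) euclidean) (bundle_shift F)"
proof -
  let ?XT = "prod_topology (sequence_space N) (euclidean :: 'a topology)"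
  have "openin ?XT {p \<in> topspace ?XT. F (shd (fst p)) (snd p) \<in> U}" if "open U" for U
  proof -
    have "{p \<in> topspace ?XT. F (shd (fst p)) (snd p) \<in> U} =
        (\<Union>i\<in>{1..N}. cylinder N [i] \<times> (F i -` U))"
      by (auto simp: topspace_sequence_space cylinder_def simp del: atLeastAtMost_iff dest: streams_shd)
    moreover have "openin ?XT (cylinder N [i] \<times> (F i -` U))" if "i \<in> {1..N}" for i
      using that assms[OF that] \<open>open U\<close>
      by (auto simp: openin_prod_Times_iff intro!: openin_cylinder open_vimage)
    ultimately show ?thesis by auto
  qed
  then have "continuous_map ?XT euclidean (\<lambda>p. F (shd (fst p)) (snd p))"
    by (simp add: continuous_map_def)
  moreover have "continuous_map ?XT (sequence_space N) (\<lambda>p. stl (fst p))"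
    using continuous_map_compose[OF continuous_map_fst continuous_map_stl]
    by (simp add: comp_def)
  moreover have "bundle_shift F = (\<lambda>p. (stl (fst p), F (shd (fst p)) (snd p)))"
    by (auto simp: bundle_shift_def)
  ultimately show ?thesis by (simp add: continuous_map_pairedI)
qed

section \<open>The fractafold bundle\<close>

text \<open>Exactly one word of length \<open>n\<close> has a cylinder containing \<open>x\<close>,
  namely \<open>stake n x\<close>, so the union over words disappears.\<close>

lemma mem_bundle_level:
  "(x, t) \<in> bundle_level N F n \<longleftrightarrow>
     x \<in> streams {1..N} \<and> fold F (stake n x) t \<in> ifs_attractor N F"
proof -
  have "stake n x \<in> words N n" if "x \<in> streams {1..N}"
  proof -
    have "set (stake n x) \<union> sset (sdrop n x) \<subseteq> {1..N}"
      using that unfolding streams_iff_sset by (metis sset_shift stake_sdrop)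
    then show ?thesis by (simp add: words_def)
  qed
  then show ?thesis
    by (auto simp: bundle_level_def fiber_def cylinder_def words_def)
qed

lemma bundle_shift_mem_bundle_level:
  assumes "nondegenerate_ifs N F" "p \<in> bundle_level N F n"
  shows "bundle_shift F p \<in> bundle_level N F n"
proof -
  obtain x t where p: "p = (x, t)" by force
  have x: "x \<in> streams {1..N}" using assms p by (simp add: mem_bundle_level)
  \<comment> \<open>The word \<open>stake (Suc n) x\<close> is split twice: at the front, where the
    shift acts, and at the end, where the last map, indexed from zero by \<open>x !! n\<close>,
    sends the attractor into itself.\<close>
  have "fold F (stake n (stl x)) (F (shd x) t) = fold F (stake (Suc n) x) t" by simp
  also have "\<dots> = F (x !! n) (fold F (stake n x) t)" by (simp only: stake_Suc) simp
  also have "\<dots> \<in> ifs_attractor N F"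
    using ifs_attractor_invariant[OF assms(1)] snth_in[OF x, of n] assms(2)
    unfolding p mem_bundle_level by blast
  finally show ?thesis using x p by (simp add: mem_bundle_level bundle_shift_def streams_stl)
qed

lemma continuous_map_bundle_level_topology:
  assumes "continuous_map (prod_topology (sequence_space N) euclidean)
             (prod_topology (sequence_space N) euclidean) f"
    and "\<And>p. p \<in> bundle_level N F n \<Longrightarrow> f p \<in> bundle_level N F m"
  shows "continuous_map (bundle_level_topology N F n) (bundle_level_topology N F m) f"
  unfolding bundle_level_topology_def using assms
  by (auto simp: continuous_map_in_subtopology intro: continuous_map_from_subtopology)

text \<open>On level \<open>n\<close>, the preimage of an open \<open>U\<close> is the preimage of
  its trace on level \<open>m\<close>. Letting \<open>m\<close> depend on \<open>n\<close> admits
  maps that raise the level.\<close>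

lemma continuous_map_fractafold_topology:
  assumes "\<And>n. \<exists>m. continuous_map (bundle_level_topology N F n) (bundle_level_topology N F m) f"
  shows "continuous_map (fractafold_topology N F) (fractafold_topology N F) f"
proof -
  have maps: "f p \<in> fractafold_bundle N F" if p: "p \<in> fractafold_bundle N F" for p
  proof -
    from p obtain n where n: "p \<in> bundle_level N F n" by (auto simp: fractafold_bundle_def)
    obtain m where "continuous_map (bundle_level_topology N F n) (bundle_level_topology N F m) f"
      using assms by blast
    from continuous_map_funspace[OF this] n show ?thesis
      by (auto simp: topspace_bundle_level_topology fractafold_bundle_def)
  qed
  have "openin (bundle_level_topology N F n)
      ({p \<in> fractafold_bundle N F. f p \<in> U} \<inter> bundle_level N F n)"
    if U: "openin (fractafold_topology N F) U" for U n
  proof -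
    obtain m where m: "continuous_map (bundle_level_topology N F n) (bundle_level_topology N F m) f"
      using assms by blast
    have "{p \<in> fractafold_bundle N F. f p \<in> U} \<inter> bundle_level N F n =
        {p \<in> topspace (bundle_level_topology N F n). f p \<in> U \<inter> bundle_level N F m}"
      using continuous_map_funspace[OF m]
      by (auto simp: topspace_bundle_level_topology fractafold_bundle_def)
    then show ?thesis
      using U openin_continuous_map_preimage[OF m, of "U \<inter> bundle_level N F m"]
      by (simp add: openin_fractafold_topology)
  qed
  with maps show ?thesis
    unfolding continuous_map_def topspace_fractafold_topology
    by (auto simp: openin_fractafold_topology)
qed

lemma continuous_map_fractafold_bundle_shift:
  assumes "nondegenerate_ifs N F"
  shows "continuous_map (fractafold_topology N F) (fractafold_topology N F) (bundle_shift F)"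
proof -
  obtain R where "0 < R" "R < 1"
    and R: "\<And>i x y. i \<in> {1..N} \<Longrightarrow> dist (F i x) (F i y) \<le> R * dist x y"
    using nondegenerate_ifs_uniform_contraction[OF assms] by blast
  then have "continuous_on UNIV (F i)" if "i \<in> {1..N}" for i
    using that by (intro dist_bound_imp_continuous_on) blast
  then show ?thesis
    using assms bundle_shift_mem_bundle_level
    by (intro continuous_map_fractafold_topology exI continuous_map_bundle_level_topology
          continuous_map_bundle_shift) auto
qed

text \<open>The lower bound \<open>r * dist x y \<le> dist (F i x) (F i y)\<close> gives injectivity
  and makes the inverse Lipschitz with constant \<open>1 / r\<close>.\<close>

lemma nondegenerate_ifs_homeomorphism:
  assumes "nondegenerate_ifs N F" "i \<in> {1..N}" "surj (F i)"
  shows "bij (F i)" "continuous_on UNIV (inv (F i))"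
proof -
  obtain r where r: "r > 0" "\<And>x y. r * dist x y \<le> dist (F i x) (F i y)"
    using assms unfolding nondegenerate_ifs_def by metis
  have "inj (F i)"
  proof (rule injI)
    fix x y assume "F i x = F i y"
    then have "r * dist x y \<le> 0" using r(2)[of x y] by simp
    then have "dist x y \<le> 0" using \<open>r > 0\<close> by (simp add: mult_le_0_iff)
    then show "x = y" by simp
  qed
  then show "bij (F i)" using assms(3) by (simp add: bij_def)
  have "dist (inv (F i) x) (inv (F i) y) \<le> (1 / r) * dist x y" for x y
    using r(2)[of "inv (F i) x" "inv (F i) y"] \<open>r > 0\<close> assms(3)
    by (simp add: surj_f_inv_f field_simps)
  then show "continuous_on UNIV (inv (F i))" by (rule dist_bound_imp_continuous_on)
qed

section \<open>Inverse branches of the bundle shift\<close>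

definition bundle_branch :: "(nat \<Rightarrow> 'a \<Rightarrow> 'a) \<Rightarrow> nat \<Rightarrow> nat stream \<times> 'a \<Rightarrow> nat stream \<times> 'a" where
  "bundle_branch F i = (\<lambda>(y, s). (i ## y, inv (F i) s))"

text \<open>Prefixing \<open>i\<close> lengthens the word by one letter. The added map
  \<open>F i\<close> acts first and cancels \<open>inv (F i)\<close>, so level \<open>n\<close>
  lands in level \<open>Suc n\<close>.\<close>

lemma continuous_map_fractafold_bundle_branch:
  fixes F :: "nat \<Rightarrow> 'a::complete_space \<Rightarrow> 'a"
  assumes "nondegenerate_ifs N F" "i \<in> {1..N}" "surj (F i)"
  shows "continuous_map (fractafold_topology N F) (fractafold_topology N F) (bundle_branch F i)"
proof (intro continuous_map_fractafold_topology exI continuous_map_bundle_level_topology)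
  let ?XT = "prod_topology (sequence_space N) (euclidean :: 'a topology)"
  have "continuous_map ?XT (sequence_space N) (\<lambda>p. i ## fst p)"
    using continuous_map_compose[OF continuous_map_fst continuous_map_SCons[OF assms(2)]]
    by (simp add: comp_def)
  moreover have "continuous_map euclidean euclidean (inv (F i))"
    using nondegenerate_ifs_homeomorphism[OF assms] by simp
  then have "continuous_map ?XT euclidean (\<lambda>p. inv (F i) (snd p))"
    by (rule continuous_map_compose[OF continuous_map_snd, unfolded comp_def])
  moreover have "bundle_branch F i = (\<lambda>p. (i ## fst p, inv (F i) (snd p)))"
    by (auto simp: bundle_branch_def)
  ultimately show "continuous_map ?XT ?XT (bundle_branch F i)"
    by (simp add: continuous_map_pairedI)
next
  fix n p assume "p \<in> bundle_level N F n"
  then show "bundle_branch F i p \<in> bundle_level N F (Suc n)"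
    using assms(2,3)
    by (cases p) (simp add: mem_bundle_level bundle_branch_def streams_Stream surj_f_inv_f)
qed

text \<open>Surjectivity of \<open>F i\<close> makes the branch a right inverse everywhere;
  injectivity makes it a left inverse where the first letter is \<open>i\<close>. The target is the
  whole bundle, so openness of the image comes for free.\<close>

lemma homeomorphic_maps_bundle_shift_branch:
  assumes "nondegenerate_ifs N F" "i \<in> {1..N}" "surj (F i)"
  shows "homeomorphic_maps
           (subtopology (fractafold_topology N F) {p \<in> fractafold_bundle N F. shd (fst p) = i})
           (fractafold_topology N F) (bundle_shift F) (bundle_branch F i)"
proof -
  have "bundle_shift F (bundle_branch F i p) = p" for p
    using assms(3) by (cases p) (simp add: bundle_shift_def bundle_branch_def surj_f_inv_f)
  moreover have "bundle_branch F i (bundle_shift F p) = p" if "shd (fst p) = i" for p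
    using that nondegenerate_ifs_homeomorphism(1)[OF assms]
    by (cases p) (auto simp: bundle_shift_def bundle_branch_def bij_is_inj)
  moreover note continuous_map_fractafold_bundle_branch[OF assms]
  moreover from continuous_map_funspace[OF this]
  have "bundle_branch F i p \<in> {p \<in> fractafold_bundle N F. shd (fst p) = i}"
    if "p \<in> fractafold_bundle N F" for p
    using that
    by (auto simp: topspace_fractafold_topology) (auto simp: bundle_branch_def split: prod.split)
  ultimately show ?thesis
    using continuous_map_fractafold_bundle_shift[OF assms(1)]
    by (auto simp: homeomorphic_maps_def continuous_map_in_subtopology
        topspace_fractafold_topology intro: continuous_map_from_subtopology)
qed

text \<open>On every level this set is the trace of one and the same open box, which is what
  openness in the inductive limit asks for.\<close>

lemma openin_fractafold_first_letter:
  fixes F :: "nat \<Rightarrow> 'a::complete_space \<Rightarrow> 'a"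
  assumes "i \<in> {1..N}"
  shows "openin (fractafold_topology N F) {p \<in> fractafold_bundle N F. shd (fst p) = i}"
proof -
  let ?XT = "prod_topology (sequence_space N) (euclidean :: 'a topology)"
  have "openin ?XT (cylinder N [i] \<times> UNIV)"
    using assms by (auto simp: openin_prod_Times_iff intro: openin_cylinder)
  moreover have "{p \<in> fractafold_bundle N F. shd (fst p) = i} \<inter> bundle_level N F n =
      (cylinder N [i] \<times> UNIV) \<inter> bundle_level N F n" for n
    by (auto simp: fractafold_bundle_def mem_bundle_level cylinder_def)
  ultimately show ?thesis
    by (auto simp: openin_fractafold_topology bundle_level_topology_def openin_subtopology)
qed

theorem corollary3p5:
  fixes F :: "nat \<Rightarrow> 'a::complete_space \<Rightarrow> 'a" and N :: nat
  assumes "nondegenerate_ifs N F"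
    and "\<And>i. i \<in> {1..N} \<Longrightarrow> surj (F i)"
  shows
   "bundle_shift F \<in> fractafold_bundle N F \<rightarrow> fractafold_bundle N F \<and>
    local_homeomorphism (fractafold_topology N F) (fractafold_topology N F) (bundle_shift F) \<and>
    (\<forall>p\<in>fractafold_bundle N F. fst (bundle_shift F p) = stl (fst p))"
proof (intro conjI ballI)
  let ?L = "fractafold_topology N F"
  show maps: "bundle_shift F \<in> fractafold_bundle N F \<rightarrow> fractafold_bundle N F"
    using continuous_map_funspace[OF continuous_map_fractafold_bundle_shift[OF assms(1)]]
    by (simp add: topspace_fractafold_topology)
  have "\<exists>U. openin ?L U \<and> p \<in> U \<and> openin ?L (bundle_shift F ` U) \<and>
      homeomorphic_map (subtopology ?L U) (subtopology ?L (bundle_shift F ` U)) (bundle_shift F)"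
    if p: "p \<in> fractafold_bundle N F" for p
  proof -
    \<comment> \<open>The neighbourhood depends only on the first letter of \<open>p\<close>; no
      shrinking around \<open>p\<close> is needed, since the shift is injective on this whole
      piece.\<close>
    define U where "U = {q \<in> fractafold_bundle N F. shd (fst q) = shd (fst p)}"
    have i: "shd (fst p) \<in> {1..N}"
      using p by (cases p) (auto simp: fractafold_bundle_def mem_bundle_level streams_shd
          simp del: atLeastAtMost_iff)
    have "homeomorphic_map (subtopology ?L U) ?L (bundle_shift F)"
      using homeomorphic_maps_bundle_shift_branch[OF assms(1) i assms(2)[OF i]]
      unfolding U_def homeomorphic_map_maps by blast
    \<comment> \<open>Since the image is the full space, it is open and its subtopology is the
      bundle topology itself.\<close>
    moreover from homeomorphic_imp_surjective_map[OF this]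
    have "bundle_shift F ` U = topspace ?L"
      by (auto simp: U_def topspace_fractafold_topology)
    ultimately show ?thesis
      using openin_fractafold_first_letter[OF i] p
      by (intro exI[of _ U]) (simp add: U_def)
  qed
  then show "local_homeomorphism ?L ?L (bundle_shift F)"
    using maps by (simp add: local_homeomorphism_def topspace_fractafold_topology)
  fix p show "fst (bundle_shift F p) = stl (fst p)"
    by (cases p) (simp add: bundle_shift_def)
qed

end
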